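(* Let $R>0$ and let $A\subset\mathbb{R}^2$ be an $R$-body such that, for every $a\in\partial A$, the set $\mathcal{N}_R(A,a)\subset S^1$ is spherically convex. Then $\mathrm{reach}(A)\ge R$.
   Context: A body is a nonempty closed subset of $\mathbb{R}^2$; $S^1$ is the unit circle; $B(x)=\{y:|y-x|<R\}$; $co(\cdot)$ convex hull. A body $A$ is an $R$-body if every $y\notin A$ lies in some open disk of radius $R$ disjoint from $A$. For $a\in\partial A$, $\mathcal{N}_R(A,a)=\{v\in S^1: A\cap B(a+Rv)=\emptyset\}$. A set $\mathcal K\subset S^1$ is spherically convex if $co(K)\cap S^1=\mathcal K$, where $K=\{\lambda v:\lambda\ge0,v\in\mathcal K\}$. $\mathrm{Unp}(A)$ is the set of points with a unique nearest point in $A$; $\mathrm{reach}(A,a)=\sup\{\rho>0:\{x:|x-a|<\rho\}\subset\mathrm{Unp}(A)\}$, $\mathrm{reach}(A)=\inf_{a\in A}\mathrm{reach}(A,a)$. *)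

theory Defs
  imports "HOL-Analysis.Analysis"
begin

definition is_body :: "(real^2) set \<Rightarrow> bool" where
  "is_body A \<longleftrightarrow> A \<noteq> {} \<and> closed A"

definition R_body :: "real \<Rightarrow> (real^2) set \<Rightarrow> bool" where
  "R_body R A \<longleftrightarrow> is_body A \<and>
     (\<forall>y. y \<notin> A \<longrightarrow> (\<exists>x. y \<in> ball x R \<and> A \<inter> ball x R = {}))"

definition normal_cone_R :: "real \<Rightarrow> (real^2) set \<Rightarrow> real^2 \<Rightarrow> (real^2) set" where
  "normal_cone_R R A a = {v \<in> sphere 0 1. A \<inter> ball (a + R *\<^sub>R v) R = {}}"

definition spherically_convex :: "(real^2) set \<Rightarrow> bool" where
  "spherically_convex KK \<longleftrightarrow>
     (convex hull {c *\<^sub>R v | c v. c \<ge> 0 \<and> v \<in> KK}) \<inter> sphere 0 1 = KK"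

definition Unp :: "(real^2) set \<Rightarrow> (real^2) set" where
  "Unp A = {x. \<exists>!y. y \<in> A \<and> (\<forall>z\<in>A. dist x y \<le> dist x z)}"

definition reach_at :: "(real^2) set \<Rightarrow> real^2 \<Rightarrow> ereal" where
  "reach_at A a = Sup {ereal \<rho> | \<rho>. \<rho> > 0 \<and> ball a \<rho> \<subseteq> Unp A}"

definition reach :: "(real^2) set \<Rightarrow> ereal" where
  "reach A = (INF a\<in>A. reach_at A a)"

end

theory Submission
  imports Defs
begin

text \<open>
  Let \<open>a\<close> be a nearest point of \<open>A\<close> to \<open>x\<close>, with \<open>r = |x - a| < R\<close> and \<open>u = (x - a) / r\<close>. If
  \<open>u\<close> lies in the \<open>R\<close>-normal set \<open>N\<close> of \<open>A\<close> at \<open>a\<close>, the open \<open>R\<close>-disk at \<open>a + R u\<close> misses \<open>A\<close>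
  and contains the closed \<open>r\<close>-disk about \<open>x\<close> except for \<open>a\<close>, so \<open>a\<close> is the only nearest point.

  Otherwise take \<open>a = 0\<close>. By spherical convexity some unit vector \<open>w\<close> has \<open>w \<bullet> u > 0\<close> and
  \<open>w \<bullet> v \<le> 0\<close> on \<open>N\<close>. For \<open>t \<down> 0\<close> the points \<open>t w\<close> are outside \<open>A\<close>, hence in \<open>R\<close>-disks about
  points \<open>z\<close> that miss \<open>A\<close>; these \<open>z\<close> tend to \<open>R v\<close> with \<open>v \<in> N\<close> and \<open>w \<bullet> v = 0\<close>. The direction
  \<open>y = z / |z|\<close> satisfies \<open>w \<bullet> y > 0\<close>, so \<open>y \<notin> N\<close> and the \<open>R\<close>-disk about \<open>R y\<close> contains some
  \<open>b \<in> A\<close>. A limit of these \<open>b\<close> lies on the circle of radius \<open>R\<close> about \<open>R v\<close>; since the disks about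
  the \<open>z\<close> miss \<open>A\<close>, it can only be \<open>0\<close>. But then \<open>b / |b|\<close> tends to \<open>w\<close>, so \<open>b\<close> enters the
  \<open>r\<close>-disk about \<open>r u\<close>, which misses \<open>A\<close>.
\<close>

section \<open>Planar coordinates and disk membership\<close>

lemma planar_orthonormal_inner:
  fixes v w b d :: "real^2"
  assumes "norm w = 1" "norm v = 1" "w \<bullet> v = 0"
  shows "b \<bullet> d = (b \<bullet> w) * (d \<bullet> w) + (b \<bullet> v) * (d \<bullet> v)"
proof -
  have ww: "w$1 * w$1 + w$2 * w$2 = 1" and vv: "v$1 * v$1 + v$2 * v$2 = 1"
    and wv: "w$1 * v$1 + w$2 * v$2 = 0"
    using assms by (simp_all add: norm_eq_1 inner_vec_def sum_2)
  \<comment> \<open>The matrix with rows \<open>w\<close>, \<open>v\<close> is orthogonal, so its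
    columns are orthonormal too.\<close>
  have 1: "w$1 * w$1 + v$1 * v$1 = 1" and 2: "w$2 * w$2 + v$2 * v$2 = 1"
    and 3: "w$1 * w$2 + v$1 * v$2 = 0"
    using ww vv wv by algebra+
  have "(b \<bullet> w) * (d \<bullet> w) + (b \<bullet> v) * (d \<bullet> v) =
      b$1 * d$1 * (w$1 * w$1 + v$1 * v$1) + b$2 * d$2 * (w$2 * w$2 + v$2 * v$2) +
      (b$1 * d$2 + b$2 * d$1) * (w$1 * w$2 + v$1 * v$2)"
    by (simp add: inner_vec_def sum_2 algebra_simps)
  also have "\<dots> = b \<bullet> d"
    unfolding 1 2 3 by (simp add: inner_vec_def sum_2)
  finally show ?thesis by simp
qed

lemma dist_less_iff_inner:
  fixes z b :: "'a::real_inner"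
  assumes "R > 0"
  shows "dist z b < R \<longleftrightarrow> b \<bullet> b - 2 * (z \<bullet> b) + z \<bullet> z < R\<^sup>2"
proof -
  have "dist z b < R \<longleftrightarrow> (norm (z - b))\<^sup>2 < R\<^sup>2"
    using assms by (auto simp: dist_norm intro: power2_less_imp_less power_strict_mono)
  also have "(norm (z - b))\<^sup>2 = b \<bullet> b - 2 * (z \<bullet> b) + z \<bullet> z"
    by (simp add: power2_norm_eq_inner inner_diff inner_commute)
  finally show ?thesis .
qed

section \<open>The limiting argument in coordinates\<close>

text \<open>
  The planar estimates of the last step, in the orthonormal frame \<open>(w, v)\<close>: \<open>y = (s, c)\<close>,
  \<open>z = \<rho> y\<close>, \<open>b = (p, q) \<longlonglongrightarrow> (P, Q)\<close> and \<open>u = (\<alpha>, \<beta>)\<close>.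
\<close>
lemma no_tangential_sequences:
  fixes s c \<rho> t p q :: "nat \<Rightarrow> real"
  assumes R: "R > 0" and r: "r > 0" and \<alpha>: "\<alpha> > 0"
    and s: "\<And>n. s n > 0" and sc: "\<And>n. (s n)\<^sup>2 + (c n)\<^sup>2 = 1"
    and \<rho>: "\<And>n. \<rho> n \<ge> R"
    and lims: "s \<longlonglongrightarrow> 0" "c \<longlonglongrightarrow> 1" "\<rho> \<longlonglongrightarrow> R" "t \<longlonglongrightarrow> 0" "p \<longlonglongrightarrow> P" "q \<longlonglongrightarrow> Q"
    and in_y: "\<And>n. (p n)\<^sup>2 + (q n)\<^sup>2 < 2 * R * (s n * p n + c n * q n)"
    and out_v: "\<And>n. 2 * R * q n \<le> (p n)\<^sup>2 + (q n)\<^sup>2"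
    and out_z: "\<And>n. R\<^sup>2 \<le> (p n)\<^sup>2 + (q n)\<^sup>2 - 2 * \<rho> n * (s n * p n + c n * q n) + (\<rho> n)\<^sup>2"
    and lim_out_z: "\<And>n. R\<^sup>2 \<le> P\<^sup>2 + Q\<^sup>2 - 2 * \<rho> n * (s n * P + c n * Q) + (\<rho> n)\<^sup>2"
    and t_in_z: "\<And>n. (\<rho> n)\<^sup>2 - 2 * t n * \<rho> n * s n + (t n)\<^sup>2 < R\<^sup>2"
    and out_u: "\<And>n. 2 * r * (\<alpha> * p n + \<beta> * q n) \<le> (p n)\<^sup>2 + (q n)\<^sup>2"
  shows False
proof -
  have c_pos: "\<forall>\<^sub>F n in sequentially. c n > 0"
    using order_tendstoD(1)[OF lims(2), of 0] by simp
  have c_le: "c n \<le> 1" for n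
  proof (rule power2_le_imp_le)
    show "(c n)\<^sup>2 \<le> 1\<^sup>2"
      using sc[of n] zero_le_power2[of "s n"] unfolding one_power2 by linarith
  qed simp
  \<comment> \<open>Comparing \<open>in_y\<close> with \<open>out_v\<close> gives
    \<open>s p > (1 - c) q\<close>, and \<open>in_y\<close> alone gives \<open>s p > - c q\<close>.
    Whatever the sign of \<open>q\<close>, one of these lower bounds is nonnegative.\<close>
  have p_pos: "p n > 0" if "c n > 0" for n
  proof -
    have "R * (s n * p n + c n * q n - q n) > 0"
      using in_y[of n] out_v[of n] by (simp add: algebra_simps)
    then have "s n * p n + c n * q n - q n > 0"
      using R by (simp only: zero_less_mult_iff) auto
    then have 1: "s n * p n > (1 - c n) * q n" by (simp add: algebra_simps)
    have "0 < 2 * R * (s n * p n + c n * q n)"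
      using in_y[of n] by (smt (verit) zero_le_power2)
    then have 2: "s n * p n > - (c n * q n)"
      using R by (simp add: zero_less_mult_iff)
    have "s n * p n > 0"
    proof (cases "q n \<ge> 0")
      case True
      then have "(1 - c n) * q n \<ge> 0" using c_le[of n] by simp
      with 1 show ?thesis by linarith
    next
      case False
      then have "c n * q n \<le> 0" using that by (simp add: mult_nonneg_nonpos)
      with 2 show ?thesis by linarith
    qed
    then show ?thesis using s[of n] by (simp add: zero_less_mult_iff)
  qed
  have PQ: "P\<^sup>2 + Q\<^sup>2 = 2 * R * Q"
  proof (rule antisym)
    have "(\<lambda>n. 2 * R * (s n * p n + c n * q n)) \<longlonglongrightarrow> 2 * R * (0 * P + 1 * Q)"
      by (intro tendsto_intros lims)
    moreover have "(\<lambda>n. (p n)\<^sup>2 + (q n)\<^sup>2) \<longlonglongrightarrow> P\<^sup>2 + Q\<^sup>2"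
      by (intro tendsto_intros lims)
    ultimately show "P\<^sup>2 + Q\<^sup>2 \<le> 2 * R * Q"
      using LIMSEQ_le[of _ "P\<^sup>2 + Q\<^sup>2" _ "2 * R * (0 * P + 1 * Q)"] in_y by (force intro: less_imp_le)
    have "(\<lambda>n. 2 * R * q n) \<longlonglongrightarrow> 2 * R * Q"
      by (intro tendsto_intros lims)
    then show "2 * R * Q \<le> P\<^sup>2 + Q\<^sup>2"
      using \<open>(\<lambda>n. (p n)\<^sup>2 + (q n)\<^sup>2) \<longlonglongrightarrow> P\<^sup>2 + Q\<^sup>2\<close> out_v LIMSEQ_le by blast
  qed
  \<comment> \<open>Being inside the \<open>R\<close>-disk at \<open>R y\<close> but outside the one
    at \<open>\<rho> y\<close>, the point \<open>b\<close> is nearer to \<open>R y\<close>, hence on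
    its side of the perpendicular bisector. In the limit this confines \<open>(P, Q)\<close> to the
    lower half \<open>Q \<le> R\<close> of the circle.\<close>
  have "2 * (s n * p n + c n * q n) \<le> \<rho> n + R" for n
  proof -
    have "(\<rho> n - R) * (\<rho> n + R - 2 * (s n * p n + c n * q n)) > 0"
      using in_y[of n] out_z[of n] by (simp add: algebra_simps power2_eq_square)
    then show ?thesis using \<rho>[of n] by (auto simp: zero_less_mult_iff)
  qed
  moreover have "(\<lambda>n. 2 * (s n * p n + c n * q n)) \<longlonglongrightarrow> 2 * (0 * P + 1 * Q)"
    by (intro tendsto_intros lims)
  moreover have "(\<lambda>n. \<rho> n + R) \<longlonglongrightarrow> R + R"
    by (intro tendsto_intros lims)
  ultimately have "2 * (0 * P + 1 * Q) \<le> R + R"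
    by (blast intro: LIMSEQ_le)
  then have Q_le: "Q \<le> R" by simp
  have Q_nonneg: "Q \<ge> 0"
  proof -
    have "0 \<le> 2 * R * Q" unfolding PQ[symmetric] by simp
    then show ?thesis using R by (simp add: zero_le_mult_iff)
  qed
  \<comment> \<open>The limit point also avoids the disks about \<open>z\<close>, while
    \<open>t_in_z\<close> bounds \<open>\<rho>^2 - R^2\<close> by \<open>2 t \<rho> s\<close>. Since
    \<open>1 - c \<le> s^2\<close> is of second order, dividing by \<open>s\<close> leaves a bound
    that still vanishes.\<close>
  have "P \<le> s n * Q + t n" if "c n > 0" for n
  proof -
    have \<rho>_pos: "\<rho> n > 0" using \<rho>[of n] R by linarith
    have "R * Q \<le> \<rho> n * Q" using \<rho>[of n] Q_nonneg by (rule mult_right_mono)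
    moreover have "(\<rho> n)\<^sup>2 - R\<^sup>2 \<le> 2 * t n * \<rho> n * s n"
      using t_in_z[of n] zero_le_power2[of "t n"] by linarith
    ultimately have "\<rho> n * (s n * P) \<le> \<rho> n * ((1 - c n) * Q + t n * s n)"
      using lim_out_z[of n] PQ by (simp add: algebra_simps)
    then have 1: "s n * P \<le> (1 - c n) * Q + t n * s n"
      using \<rho>_pos by (simp add: mult_le_cancel_left_pos)
    have "(1 - c n) * 1 \<le> (1 - c n) * (1 + c n)"
      using that c_le[of n] by (intro mult_left_mono) auto
    also have "\<dots> = (s n)\<^sup>2" using sc[of n] by (simp add: algebra_simps power2_eq_square)
    finally have "(1 - c n) * Q \<le> (s n)\<^sup>2 * Q" using Q_nonneg by (simp add: mult_right_mono)
    with 1 have "s n * P \<le> s n * (s n * Q + t n)"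
      by (simp add: algebra_simps power2_eq_square)
    then show ?thesis using s[of n] by (simp add: mult_le_cancel_left_pos)
  qed
  then have "\<forall>\<^sub>F n in sequentially. P \<le> s n * Q + t n"
    using c_pos by (auto elim: eventually_mono)
  moreover have "(\<lambda>n. s n * Q + t n) \<longlonglongrightarrow> 0 * Q + 0"
    by (intro tendsto_intros lims)
  ultimately have "P \<le> 0"
    using tendsto_lowerbound[of _ "0 * Q + 0" sequentially P] by simp
  moreover have "P \<ge> 0"
    using c_pos p_pos by (intro tendsto_lowerbound[OF lims(5)]) (auto elim!: eventually_mono intro: less_imp_le)
  ultimately have P0: "P = 0" by simp
  with PQ have "Q = 0 \<or> Q = 2 * R" by (simp add: power2_eq_square)
  with Q_le R have Q0: "Q = 0" by auto
  \<comment> \<open>The slope of \<open>b\<close> against the axis \<open>w\<close>. It is squeezed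
    to 0: \<open>in_y\<close> bounds it below by \<open>- s / c\<close>, and \<open>out_v\<close>
    bounds it above by \<open>p / (2 R - q)\<close>.\<close>
  define \<sigma> where "\<sigma> n = q n / p n" for n
  have "\<forall>\<^sub>F n in sequentially. 2 * R - q n > 0"
    using order_tendstoD(2)[OF lims(6), of "2 * R"] Q0 R by simp
  then have ev: "\<forall>\<^sub>F n in sequentially. c n > 0 \<and> 2 * R - q n > 0"
    using c_pos by eventually_elim simp
  have \<sigma>_eq: "q n = \<sigma> n * p n" if "c n > 0" for n
    using p_pos[OF that] by (simp add: \<sigma>_def)
  have lower: "- s n / c n \<le> \<sigma> n" if "c n > 0" for n
  proof -
    have "0 < 2 * R * (s n * p n + c n * q n)"
      using in_y[of n] by (smt (verit) zero_le_power2)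
    then have "s n * p n + c n * q n > 0"
      using R by (simp add: zero_less_mult_iff)
    then have "p n * (s n + c n * \<sigma> n) > 0"
      by (simp add: \<sigma>_eq[OF that] algebra_simps)
    then have "s n + c n * \<sigma> n > 0"
      using p_pos[OF that] by (simp add: zero_less_mult_iff)
    then show ?thesis using that by (simp add: field_simps)
  qed
  have upper: "\<sigma> n \<le> p n / (2 * R - q n)" if "c n > 0" "2 * R - q n > 0" for n
  proof -
    have "p n * (\<sigma> n * (2 * R - q n)) \<le> p n * p n"
      using out_v[of n] \<sigma>_eq[OF that(1)] by (simp add: algebra_simps power2_eq_square)
    then have "\<sigma> n * (2 * R - q n) \<le> p n"
      using p_pos[OF that(1)] by (simp add: mult_le_cancel_left_pos)
    then show ?thesis using that by (simp add: pos_le_divide_eq)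
  qed
  have "(\<lambda>n. - s n / c n) \<longlonglongrightarrow> - 0 / 1"
    by (intro tendsto_intros lims) simp
  moreover have "(\<lambda>n. p n / (2 * R - q n)) \<longlonglongrightarrow> 0 / (2 * R - 0)"
    using lims(5,6) R unfolding P0 Q0 by (intro tendsto_intros) auto
  ultimately have \<sigma>_lim: "\<sigma> \<longlonglongrightarrow> 0"
    using ev lower upper
    by (intro tendsto_sandwich[of "\<lambda>n. - s n / c n" \<sigma> _ "\<lambda>n. p n / (2 * R - q n)"])
      (auto elim!: eventually_mono)
  \<comment> \<open>This is \<open>out_u\<close> divided by \<open>p > 0\<close>; its left side
    tends to \<open>2 r \<alpha> > 0\<close>, its right side to 0.\<close>
  have "2 * r * (\<alpha> + \<beta> * \<sigma> n) \<le> p n + q n * \<sigma> n" if "c n > 0" for n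
  proof -
    have "p n * (2 * r * (\<alpha> + \<beta> * \<sigma> n)) \<le> p n * (p n + q n * \<sigma> n)"
      using out_u[of n] \<sigma>_eq[OF that] by (simp add: algebra_simps power2_eq_square)
    then show ?thesis using p_pos[OF that] by (simp add: mult_le_cancel_left_pos)
  qed
  then have "\<forall>\<^sub>F n in sequentially. 2 * r * (\<alpha> + \<beta> * \<sigma> n) \<le> p n + q n * \<sigma> n"
    using c_pos by (auto elim: eventually_mono)
  moreover have "(\<lambda>n. 2 * r * (\<alpha> + \<beta> * \<sigma> n)) \<longlonglongrightarrow> 2 * r * (\<alpha> + \<beta> * 0)"
    by (intro tendsto_intros \<sigma>_lim)
  moreover have "(\<lambda>n. p n + q n * \<sigma> n) \<longlonglongrightarrow> 0 + 0 * 0"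
    using lims(5,6) \<sigma>_lim unfolding P0 Q0 by (intro tendsto_intros)
  ultimately have "2 * r * (\<alpha> + \<beta> * 0) \<le> 0 + 0 * 0"
    using tendsto_le[OF trivial_limit_sequentially] by blast
  then show False using r \<alpha> by (simp add: mult_le_0_iff)
qed

section \<open>From spherical convexity to the normal set\<close>

text \<open>Spherical convexity makes the cone over a nonempty normal set convex, and compactness of
  that set makes it closed. A hyperplane then separates the cone strictly from \<open>u\<close>, and
  its normal yields \<open>w\<close>.\<close>

lemma separating_direction:
  fixes R :: real and A :: "(real^2) set"
  assumes sc: "spherically_convex (normal_cone_R R A a)"
    and u: "norm u = 1" "u \<notin> normal_cone_R R A a"
  obtains w where "norm w = 1" "w \<bullet> u > 0" "\<And>v. v \<in> normal_cone_R R A a \<Longrightarrow> w \<bullet> v \<le> 0"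
proof (cases "normal_cone_R R A a = {}")
  case True
  with u that[of u] show ?thesis by (simp add: norm_eq_1)
next
  case False
  define N where "N = normal_cone_R R A a"
  define K where "K = conic hull N"
  have N: "v \<in> N \<longleftrightarrow> norm v = 1 \<and> (\<forall>b\<in>A. R \<le> dist (a + R *\<^sub>R v) b)" for v
    by (auto simp: N_def normal_cone_R_def not_less)
  have "N = sphere 0 1 \<inter> (\<Inter>b\<in>A. {v. R \<le> dist (a + R *\<^sub>R v) b})"
    using N by auto
  moreover have "closed {v. R \<le> dist (a + R *\<^sub>R v) b}" for b
    by (intro closed_Collect_le continuous_intros)
  ultimately have "compact N"
    by (auto intro!: compact_Int_closed)
  moreover have "0 \<notin> N" by (simp add: N)
  ultimately have "closed K" unfolding K_def by (intro closed_conic_hull) simp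
  have hull: "convex hull K \<inter> sphere 0 1 = N"
    using sc by (simp add: spherically_convex_def K_def N_def conic_hull_explicit)
  have "cone (convex hull K)"
    unfolding K_def conic_hull_explicit
    by (rule cone_convex_hull) (force simp: cone_def intro: mult_nonneg_nonneg)
  have "K \<noteq> {}" using False by (simp add: K_def N_def conic_hull_eq_empty)
  then have "0 \<in> K" by (simp add: K_def conic_contains_0 conic_conic_hull conic_hull_eq_empty)
  \<comment> \<open>A nonzero point of the hull rescales to a unit vector, which \<open>hull\<close>
    places in \<open>N\<close>; so the cone is its own convex hull.\<close>
  have "x \<in> K" if "x \<in> convex hull K" for x
  proof (cases "x = 0")
    case False
    then have "(1 / norm x) *\<^sub>R x \<in> convex hull K \<inter> sphere 0 1"
      using \<open>cone (convex hull K)\<close> that by (simp add: cone_def)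
    then have "(1 / norm x) *\<^sub>R x \<in> N" using hull by simp
    then have "norm x *\<^sub>R ((1 / norm x) *\<^sub>R x) \<in> K"
      unfolding K_def conic_hull_explicit using norm_ge_zero[of x] by blast
    then show ?thesis using False by simp
  qed (use \<open>0 \<in> K\<close> in simp)
  then have "convex hull K = K" using hull_subset[of K convex] by auto
  then have "convex K" by (metis convex_convex_hull)
  have "u \<notin> K" using u hull \<open>convex hull K = K\<close> by (auto simp: N_def)
  from separating_hyperplane_closed_point[OF \<open>convex K\<close> \<open>closed K\<close> this]
  obtain d e where de: "d \<bullet> u < e" "\<And>x. x \<in> K \<Longrightarrow> d \<bullet> x > e" by blast
  from de(2)[OF \<open>0 \<in> K\<close>] have "e < 0" by simp
  \<comment> \<open>If \<open>d \<bullet> v\<close> were negative, the multiple of \<open>v\<close>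
    by \<open>e / (d \<bullet> v)\<close> would be in the cone with inner product exactly
    \<open>e\<close>.\<close>
  have nonneg: "d \<bullet> v \<ge> 0" if "v \<in> N" for v
  proof (rule ccontr)
    assume neg: "\<not> 0 \<le> d \<bullet> v"
    have "(e / (d \<bullet> v)) *\<^sub>R v \<in> K"
      unfolding K_def conic_hull_explicit using that neg \<open>e < 0\<close>
      by (auto intro!: exI[of _ "e / (d \<bullet> v)"] exI[of _ v] simp: divide_nonpos_nonpos)
    from de(2)[OF this] neg show False by simp
  qed
  have "d \<noteq> 0" using de(1) \<open>e < 0\<close> by auto
  show ?thesis
  proof (rule that)
    show "norm (- sgn d) = 1" using \<open>d \<noteq> 0\<close> by (simp add: norm_sgn)
    show "- sgn d \<bullet> u > 0"
      using \<open>d \<noteq> 0\<close> de(1) \<open>e < 0\<close> by (simp add: sgn_div_norm mult_less_0_iff divide_less_0_iff)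
    show "- sgn d \<bullet> v \<le> 0" if "v \<in> normal_cone_R R A a" for v
      using nonneg that by (simp add: sgn_div_norm N_def)
  qed
qed

text \<open>Builds the sequences that \<open>no_tangential_sequences\<close> excludes, with the
  nearest point moved to the origin.\<close>

lemma proximal_direction_not_separated:
  fixes A :: "(real^2) set"
  assumes R: "R > 0" and "closed A" and "0 \<in> A"
    and cover: "\<And>y. y \<notin> A \<Longrightarrow> \<exists>z. y \<in> ball z R \<and> A \<inter> ball z R = {}"
    and r: "r > 0" and u: "norm u = 1" and out_u: "A \<inter> ball (r *\<^sub>R u) r = {}"
    and w: "norm w = 1" and wu: "w \<bullet> u > 0"
    and sep: "\<And>v. norm v = 1 \<Longrightarrow> A \<inter> ball (R *\<^sub>R v) R = {} \<Longrightarrow> w \<bullet> v \<le> 0"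
  shows False
proof -
  \<comment> \<open>The point \<open>t w\<close> lies in the disk at \<open>r u\<close> exactly when
    \<open>0 < t < 2 r (w \<bullet> u)\<close>, which holds here from \<open>n = 0\<close>
    on.\<close>
  define t where "t n = r * (w \<bullet> u) / real (Suc n)" for n
  have t_pos: "t n > 0" for n using r wu by (simp add: t_def)
  have t_lim: "t \<longlonglongrightarrow> 0"
    unfolding t_def by (rule LIMSEQ_Suc[OF lim_const_over_n])
  have "t n *\<^sub>R w \<notin> A" for n
  proof -
    have "t n \<le> r * (w \<bullet> u) / 1"
      unfolding t_def using r wu by (intro divide_left_mono) auto
    moreover have "r * (w \<bullet> u) > 0" using r wu by simp
    ultimately have "t n < 2 * r * (w \<bullet> u)" by linarith
    then have "t n * t n < t n * (2 * r * (w \<bullet> u))"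
      using t_pos by (simp add: mult_less_cancel_left_pos)
    then have "t n *\<^sub>R w \<in> ball (r *\<^sub>R u) r"
      using u w by (simp add: dist_less_iff_inner[OF r] norm_eq_1 inner_commute[of u w] power2_eq_square algebra_simps)
    then show ?thesis using out_u by auto
  qed
  then have "\<forall>n. \<exists>z. t n *\<^sub>R w \<in> ball z R \<and> A \<inter> ball z R = {}" using cover by blast
  then obtain z where z: "\<And>n. t n *\<^sub>R w \<in> ball (z n) R" "\<And>n. A \<inter> ball (z n) R = {}"
    by metis
  have z_ge: "norm (z n) \<ge> R" for n
    using z(2)[of n] \<open>0 \<in> A\<close> by (auto simp: dist_norm disjoint_iff not_less)
  have z_le: "norm (z n) \<le> R + t n" for n
  proof -
    have "norm (z n) \<le> norm (z n - t n *\<^sub>R w) + norm (t n *\<^sub>R w)"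
      using norm_triangle_sub[of "z n" "t n *\<^sub>R w"] by simp
    also have "norm (t n *\<^sub>R w) = t n" using w t_pos[of n] by simp
    finally show ?thesis using z(1)[of n] by (simp add: dist_norm)
  qed
  have z_lim: "(\<lambda>n. norm (z n)) \<longlonglongrightarrow> R"
  proof (rule tendsto_sandwich)
    show "(\<lambda>n. R) \<longlonglongrightarrow> R" by simp
    show "(\<lambda>n. R + t n) \<longlonglongrightarrow> R" using tendsto_add[OF tendsto_const t_lim, of R] by simp
  qed (use z_ge z_le in auto)
  have t_in: "(norm (z n))\<^sup>2 - 2 * t n * (w \<bullet> z n) + (t n)\<^sup>2 < R\<^sup>2" for n
    using z(1)[of n] w
    by (simp add: dist_less_iff_inner[OF R] dot_square_norm inner_commute[of w "z n"] power_mult_distrib algebra_simps)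
  have wz: "w \<bullet> z n > 0" for n
  proof -
    have "R\<^sup>2 \<le> (norm (z n))\<^sup>2" using z_ge[of n] R by simp
    then have "t n * (w \<bullet> z n) > 0"
      using t_in[of n] zero_le_power2[of "t n"] by linarith
    then show ?thesis using t_pos[of n] by (simp add: zero_less_mult_iff)
  qed
  define y where "y n = z n /\<^sub>R norm (z n)" for n
  have z_pos: "norm (z n) > 0" for n using z_ge[of n] R by linarith
  have y_norm: "norm (y n) = 1" for n using z_pos[of n] by (simp add: y_def)
  have zy: "z n = norm (z n) *\<^sub>R y n" for n using z_pos[of n] by (simp add: y_def)
  have wy: "w \<bullet> y n > 0" for n using wz[of n] z_pos[of n] by (simp add: y_def)
  then have yw: "y n \<bullet> w > 0" for n by (simp add: inner_commute)
  have "\<forall>n. \<exists>b. b \<in> A \<and> b \<in> ball (R *\<^sub>R y n) R"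
    using sep[OF y_norm] wy by (metis disjoint_iff not_less)
  then obtain b where b: "\<And>n. b n \<in> A" "\<And>n. b n \<in> ball (R *\<^sub>R y n) R" by metis
  have "norm (b n) \<le> 2 * R" for n
  proof -
    have "norm (b n) \<le> norm (R *\<^sub>R y n) + norm (R *\<^sub>R y n - b n)"
      by (metis norm_minus_commute norm_triangle_sub)
    also have "norm (R *\<^sub>R y n) = R" using y_norm[of n] R by simp
    finally show ?thesis using b(2)[of n] by (simp add: dist_norm)
  qed
  \<comment> \<open>Pairing \<open>y\<close> with \<open>b\<close> lets one subsequence serve
    both.\<close>
  then have "bounded (range (\<lambda>n. (y n, b n)))"
    by (intro boundedI[of _ "1 + 2 * R"])
      (use y_norm in \<open>force intro: order.trans[OF norm_Pair_le] add_mono\<close>)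
  then obtain l f where f: "strict_mono f" and "((\<lambda>n. (y n, b n)) \<circ> f) \<longlonglongrightarrow> l"
    using bounded_imp_convergent_subsequence by blast
  then obtain v b' where l: "((\<lambda>n. (y n, b n)) \<circ> f) \<longlonglongrightarrow> (v, b')" by (cases l) auto
  have y_lim: "(\<lambda>n. y (f n)) \<longlonglongrightarrow> v" and b_lim: "(\<lambda>n. b (f n)) \<longlonglongrightarrow> b'"
    using tendsto_fst[OF l] tendsto_snd[OF l] by (simp_all add: o_def)
  have z_lim': "(\<lambda>n. norm (z (f n))) \<longlonglongrightarrow> R" and t_lim': "(\<lambda>n. t (f n)) \<longlonglongrightarrow> 0"
    using LIMSEQ_subseq_LIMSEQ[OF z_lim f] LIMSEQ_subseq_LIMSEQ[OF t_lim f] by (simp_all add: o_def)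
  have v_norm: "norm v = 1"
    using tendsto_norm[OF y_lim] y_norm by (simp add: LIMSEQ_const_iff)
  have b'A: "b' \<in> A"
    using \<open>closed A\<close> b(1) b_lim closed_sequentially[of A "\<lambda>n. b (f n)"] by blast
  \<comment> \<open>The empty disks about \<open>z\<close> pass to the limit, so \<open>sep\<close>
    applies to \<open>v\<close>; with \<open>w \<bullet> y > 0\<close> this makes \<open>w\<close>,
    \<open>v\<close> an orthonormal frame.\<close>
  have "R \<le> dist (R *\<^sub>R v) x" if "x \<in> A" for x
  proof (rule tendsto_lowerbound)
    show "(\<lambda>n. dist (norm (z (f n)) *\<^sub>R y (f n)) x) \<longlonglongrightarrow> dist (R *\<^sub>R v) x"
      by (intro tendsto_intros z_lim' y_lim)
    have "R \<le> dist (z n) x" for n using z(2)[of n] that by (auto simp: disjoint_iff not_less)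
    then show "\<forall>\<^sub>F n in sequentially. R \<le> dist (norm (z (f n)) *\<^sub>R y (f n)) x"
      using zy by simp
  qed simp
  then have out_v: "A \<inter> ball (R *\<^sub>R v) R = {}" by (auto simp: disjoint_iff not_less)
  have "w \<bullet> v \<ge> 0"
    by (rule tendsto_lowerbound[OF tendsto_inner[OF tendsto_const y_lim]])
      (simp_all add: less_imp_le[OF wy])
  with sep[OF v_norm out_v] have wv: "w \<bullet> v = 0" by simp
  note dec = planar_orthonormal_inner[OF w v_norm wv]
  have sq: "x \<bullet> x = (x \<bullet> w)\<^sup>2 + (x \<bullet> v)\<^sup>2" for x
    using dec[of x x] by (simp add: power2_eq_square)
  have yx: "y n \<bullet> x = (y n \<bullet> w) * (x \<bullet> w) + (y n \<bullet> v) * (x \<bullet> v)" for n x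
    by (rule dec)
  have out_ball: "R\<^sup>2 \<le> x \<bullet> x - 2 * (c \<bullet> x) + c \<bullet> c" if "x \<in> A" "A \<inter> ball c R = {}" for x c
    using that dist_less_iff_inner[OF R, of c x] by (auto simp: disjoint_iff not_less)
  have zz: "z n \<bullet> z n = (norm (z n))\<^sup>2" for n by (simp add: power2_norm_eq_inner)
  have zx: "z n \<bullet> x = norm (z n) * ((y n \<bullet> w) * (x \<bullet> w) + (y n \<bullet> v) * (x \<bullet> v))" for n x
    by (metis inner_scaleR_left zy yx)
  \<comment> \<open>Stated for every point of \<open>A\<close> because it serves both
    \<open>b\<close> and its limit \<open>b'\<close>.\<close>
  have z_out: "R\<^sup>2 \<le> (x \<bullet> w)\<^sup>2 + (x \<bullet> v)\<^sup>2 - 2 * norm (z n) * (y n \<bullet> w * (x \<bullet> w) + y n \<bullet> v * (x \<bullet> v)) + (norm (z n))\<^sup>2"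
    if "x \<in> A" for x n
    using out_ball[OF that z(2)[of n]] by (simp add: zx[of n x] zz sq[of x])
  show False
  proof (rule no_tangential_sequences[of R r "w \<bullet> u" "\<lambda>n. y (f n) \<bullet> w"
        "\<lambda>n. y (f n) \<bullet> v" "\<lambda>n. norm (z (f n))" "\<lambda>n. t (f n)" "\<lambda>n. b (f n) \<bullet> w" "b' \<bullet> w"
        "\<lambda>n. b (f n) \<bullet> v" "b' \<bullet> v" "u \<bullet> v"])
    show "(y (f n) \<bullet> w)\<^sup>2 + (y (f n) \<bullet> v)\<^sup>2 = 1" for n
      using sq[of "y (f n)"] y_norm by (simp add: norm_eq_1)
    show "(\<lambda>n. y (f n) \<bullet> w) \<longlonglongrightarrow> 0"
      using tendsto_inner[OF y_lim tendsto_const[of w]] wv by (simp add: inner_commute)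
    show "(\<lambda>n. y (f n) \<bullet> v) \<longlonglongrightarrow> 1"
      using tendsto_inner[OF y_lim tendsto_const[of v]] v_norm by (simp add: norm_eq_1)
    show "(\<lambda>n. b (f n) \<bullet> w) \<longlonglongrightarrow> b' \<bullet> w" "(\<lambda>n. b (f n) \<bullet> v) \<longlonglongrightarrow> b' \<bullet> v"
      by (intro tendsto_intros b_lim)+
    show "(b (f n) \<bullet> w)\<^sup>2 + (b (f n) \<bullet> v)\<^sup>2 <
        2 * R * (y (f n) \<bullet> w * (b (f n) \<bullet> w) + y (f n) \<bullet> v * (b (f n) \<bullet> v))" for n
      using b(2)[of "f n"] y_norm[of "f n"]
      by (simp add: dist_less_iff_inner[OF R] norm_eq_1 sq[of "b (f n)"] yx[of "f n" "b (f n)"] power2_eq_square algebra_simps)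
    show "2 * R * (b (f n) \<bullet> v) \<le> (b (f n) \<bullet> w)\<^sup>2 + (b (f n) \<bullet> v)\<^sup>2" for n
      using out_ball[OF b(1)[of "f n"] out_v] v_norm
      by (simp add: sq[of "b (f n)"] norm_eq_1 inner_commute[of v "b (f n)"] power2_eq_square algebra_simps)
    show "(norm (z (f n)))\<^sup>2 - 2 * t (f n) * norm (z (f n)) * (y (f n) \<bullet> w) + (t (f n))\<^sup>2 < R\<^sup>2" for n
      using t_in[of "f n"] zx[of "f n" w] w wv
      by (simp add: inner_commute[of w "z (f n)"] norm_eq_1 algebra_simps)
    show "2 * r * (w \<bullet> u * (b (f n) \<bullet> w) + u \<bullet> v * (b (f n) \<bullet> v)) \<le> (b (f n) \<bullet> w)\<^sup>2 + (b (f n) \<bullet> v)\<^sup>2" for n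
    proof -
      have "b (f n) \<notin> ball (r *\<^sub>R u) r" using b(1)[of "f n"] out_u by auto
      then have "2 * r * (u \<bullet> b (f n)) \<le> b (f n) \<bullet> b (f n)"
        using u by (simp add: dist_less_iff_inner[OF r] norm_eq_1 power2_eq_square algebra_simps)
      then show ?thesis by (simp add: dec[of u "b (f n)"] sq[of "b (f n)"] inner_commute[of w u])
    qed
  qed (use R r wu yw z_ge z_lim' t_lim' z_out b(1) b'A in \<open>simp_all\<close>)
qed

text \<open>Otherwise \<open>separating_direction\<close> supplies a \<open>w\<close> that is
  impossible once \<open>a\<close> is translated to the origin.\<close>

lemma proximal_normal_in_normal_cone_R:
  fixes R :: real and A :: "(real^2) set"
  assumes R: "R > 0" and body: "R_body R A" and a: "a \<in> A"
    and sc: "spherically_convex (normal_cone_R R A a)"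
    and r: "r > 0" and u: "norm u = 1" and out: "A \<inter> ball (a + r *\<^sub>R u) r = {}"
  shows "u \<in> normal_cone_R R A a"
proof (rule ccontr)
  assume "u \<notin> normal_cone_R R A a"
  then obtain w where w: "norm w = 1" "w \<bullet> u > 0" "\<And>v. v \<in> normal_cone_R R A a \<Longrightarrow> w \<bullet> v \<le> 0"
    using separating_direction[OF sc u] by blast
  let ?B = "(+) (- a) ` A"
  have B: "x \<in> ?B \<longleftrightarrow> a + x \<in> A" for x
    by (auto intro: rev_image_eqI[of "a + x"])
  have ball: "x \<in> ball c s \<longleftrightarrow> a + x \<in> ball (a + c) s" for x c s
    by (simp add: dist_norm)
  have disj: "?B \<inter> ball c s = {} \<longleftrightarrow> A \<inter> ball (a + c) s = {}" for c s
  proof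
    assume "?B \<inter> ball c s = {}"
    then show "A \<inter> ball (a + c) s = {}"
      using B[of "- a + x" for x] ball[of "- a + x" for x] by (auto simp: disjoint_iff)
  next
    assume "A \<inter> ball (a + c) s = {}"
    then show "?B \<inter> ball c s = {}" using B ball by (auto simp: disjoint_iff)
  qed
  show False
  proof (rule proximal_direction_not_separated[OF R _ _ _ r u _ w(1,2)])
    show "closed ?B" using body unfolding R_body_def is_body_def by (blast intro: closed_translation)
    show "0 \<in> ?B" using a B[of 0] by simp
    show "\<exists>z. x \<in> ball z R \<and> ?B \<inter> ball z R = {}" if "x \<notin> ?B" for x
    proof -
      from that obtain z where "a + x \<in> ball z R" "A \<inter> ball z R = {}"
        using body B unfolding R_body_def by blast
      then show ?thesis
        using ball[of x "z - a" R] disj[of "z - a" R] by (intro exI[of _ "z - a"]) simp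
    qed
    show "?B \<inter> ball (r *\<^sub>R u) r = {}" using out disj by simp
    show "w \<bullet> v \<le> 0" if "norm v = 1" "?B \<inter> ball (R *\<^sub>R v) R = {}" for v
      using w(3)[of v] that disj by (simp add: normal_cone_R_def)
  qed
qed

section \<open>Unique nearest points and the reach\<close>

theorem mainTheorem19:
  fixes R :: real and A :: "(real^2) set"
  assumes "R > 0"
    and "R_body R A"
    and "\<forall>a\<in>frontier A. spherically_convex (normal_cone_R R A a)"
  shows "reach A \<ge> ereal R"
proof -
  have cl: "closed A" and ne: "A \<noteq> {}"
    using assms(2) by (auto simp: R_body_def is_body_def)
  have unp: "x \<in> Unp A" if "a0 \<in> A" "dist a0 x < R" for a0 x
  proof -
    obtain a where a: "a \<in> A" "\<And>y. y \<in> A \<Longrightarrow> dist x a \<le> dist x y"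
      using distance_attains_inf[OF cl ne] by blast
    define r where "r = dist x a"
    have "r < R" using a(2)[OF that(1)] that(2) by (simp add: r_def dist_commute)
    have "b = a" if b: "b \<in> A" "dist x b \<le> r" for b
    proof (cases "r = 0")
      case True
      then show ?thesis using b(2) by (simp add: r_def)
    next
      case False
      then have r: "r > 0" by (simp add: r_def)
      define u where "u = (x - a) /\<^sub>R r"
      have u: "norm u = 1" using r by (simp add: u_def r_def dist_norm)
      have x: "x = a + r *\<^sub>R u" using r by (simp add: u_def)
      have out: "A \<inter> ball (a + r *\<^sub>R u) r = {}"
        unfolding x[symmetric] using a(2) by (auto simp: disjoint_iff not_less r_def)
      \<comment> \<open>Spherical convexity is given on the frontier; \<open>a\<close> is there as a
        boundary point of a disk that misses \<open>A\<close>.\<close>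
      have "a \<in> closure (- A)"
      proof -
        have "ball x r \<subseteq> - A" using out unfolding x[symmetric] by auto
        moreover have "a \<in> closure (ball x r)" using r by (simp add: closure_ball r_def)
        ultimately show ?thesis using closure_mono by blast
      qed
      then have "a \<in> frontier A" using a(1) cl by (simp add: frontier_closures)
      then have "u \<in> normal_cone_R R A a"
        using proximal_normal_in_normal_cone_R[OF assms(1,2) a(1) _ r u out] assms(3) by blast
      then have "b - a \<notin> ball (R *\<^sub>R u) R"
        using b(1) by (auto simp: normal_cone_R_def disjoint_iff dist_norm algebra_simps)
      \<comment> \<open>With \<open>d = b - a\<close>, the \<open>R\<close>-disk gives
        \<open>2 R (u \<bullet> d) \<le> d \<bullet> d\<close> and the choice of \<open>b\<close>
        gives \<open>d \<bullet> d \<le> 2 r (u \<bullet> d)\<close>. As \<open>r < R\<close>, both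
        are possible only for \<open>d = 0\<close>.\<close>
      then have 1: "2 * R * (u \<bullet> (b - a)) \<le> (b - a) \<bullet> (b - a)"
        using u by (simp add: dist_less_iff_inner[OF assms(1)] norm_eq_1 power2_eq_square not_less)
      have norm_sq: "(norm (r *\<^sub>R u - d))\<^sup>2 = r\<^sup>2 - 2 * r * (u \<bullet> d) + d \<bullet> d" for d
        using u unfolding power2_norm_eq_inner
        by (simp add: inner_diff_left inner_diff_right norm_eq_1 power2_eq_square inner_commute[of d u] algebra_simps)
      have "(norm (r *\<^sub>R u - (b - a)))\<^sup>2 \<le> r\<^sup>2"
        using b(2) r by (intro power_mono) (simp_all add: x dist_norm algebra_simps)
      then have 2: "(b - a) \<bullet> (b - a) \<le> 2 * r * (u \<bullet> (b - a))"
        unfolding norm_sq by linarith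
      then have "2 * r * (u \<bullet> (b - a)) \<ge> 0" by (rule order.trans[OF inner_ge_zero])
      then have "u \<bullet> (b - a) \<ge> 0" using r by (simp add: zero_le_mult_iff)
      moreover have "(R - r) * (u \<bullet> (b - a)) \<le> 0" using 1 2 by (simp add: algebra_simps)
      ultimately have "u \<bullet> (b - a) = 0" using \<open>r < R\<close> by (auto simp: mult_le_0_iff)
      with 2 have "(b - a) \<bullet> (b - a) \<le> 0" by simp
      then show ?thesis by (metis eq_iff_diff_eq_0 inner_gt_zero_iff not_less)
    qed
    then show ?thesis
      unfolding Unp_def mem_Collect_eq using a by (intro ex1I[of _ a]) (auto simp: r_def)
  qed
  show ?thesis
    unfolding reach_def
  proof (rule INF_greatest)
    fix a assume "a \<in> A"
    then have "ball a R \<subseteq> Unp A" using unp by auto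
    then show "ereal R \<le> reach_at A a"
      unfolding reach_at_def using assms(1) by (intro Sup_upper) auto
  qed
qed

end
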